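(* Let $\beta$ be an integer. If there exists an extremal singly even self-dual $[62,31,12]$ code $C$ whose shadow has minimum weight at least $7$, with weight enumerator \[ W_{62} = 1 + (1860+32\beta)y^{12} + (28055-160\beta)y^{14}+ \cdots \] and shadow weight enumerator \[ S_{62} = \beta y^7 + (1116-12\beta)y^{11}+(171368+ 66 \beta) y^{15} + \cdots, \] then $0 \le \beta \le 48$.
   Context: All codes are binary linear codes; an $[n,k,d]$ code has length $n$, dimension $k$ and minimum nonzero weight $d$. A code $C$ is self-dual if $C=C^\perp$ with respect to the standard inner product; a self-dual code is singly even if it contains a codeword of weight $\equiv 2 \pmod 4$. For a singly even self-dual code $C$, let $C_0$ be the subcode of codewords of weight $\equiv 0 \pmod 4$. The shadow of $C$ is $S=C_0^\perp\setminus C$. The weight enumerators of $C$ and $S$ are $\sum_i A_i y^i$ and $\sum_i B_i y^i$, where $A_i$ and $B_i$ are the numbers of vectors of weight $i$ in $C$ and $S$ respectively; the dots denote terms of higher degree. Extremal means meeting the upper bound on the minimum weight of self-dual codes of the given length: $d\le 4\lfloor n/24\rfloor+6$ if $n\equiv 22\pmod{24}$ and $d\le 4\lfloor n/24\rfloor+4$ otherwise; for $n=62$ this is $d=12$. Known (Conway–Sloane): every singly even self-dual $[62,31,12]$ code whose shadow has minimum weight at least $7$ has weight enumerators of the stated form for some integer $\beta$ with $0\le\beta\le 93$. *)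

theory Defs
  imports
    "HOL-Analysis.Cartesian_Space"
    "HOL-Library.Z2"
    "HOL-Library.Numeral_Type"
    "HOL-Computational_Algebra.Polynomial"
begin

text \<open>Binary codes of length \<open>n\<close> are sets of vectors over the two-element field \<^typ>\<open>bit\<close>,
  indexed by a finite type with \<open>n\<close> elements.\<close>

definition hamming_weight :: "bit ^ 'n::finite \<Rightarrow> nat" where
  "hamming_weight v = card {i. v $ i \<noteq> 0}"

definition dot :: "bit ^ 'n::finite \<Rightarrow> bit ^ 'n \<Rightarrow> bit" where
  "dot x y = (\<Sum>i\<in>UNIV. x $ i * y $ i)"

definition dual_code :: "(bit ^ 'n::finite) set \<Rightarrow> (bit ^ 'n) set" where
  "dual_code C = {x. \<forall>c\<in>C. dot x c = 0}"

text \<open>The minimum is unspecified when the set has no nonzero vector.\<close>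

definition min_weight :: "(bit ^ 'n::finite) set \<Rightarrow> nat" where
  "min_weight A = Min (hamming_weight ` (A - {0}))"

definition linear_code :: "nat \<Rightarrow> nat \<Rightarrow> nat \<Rightarrow> (bit ^ 'n::finite) set \<Rightarrow> bool" where
  "linear_code n k d C \<longleftrightarrow>
     CARD('n) = n \<and> vec.subspace C \<and> vec.dim C = k \<and> C \<noteq> {0} \<and> min_weight C = d"

definition self_dual :: "(bit ^ 'n::finite) set \<Rightarrow> bool" where
  "self_dual C \<longleftrightarrow> C = dual_code C"

definition singly_even :: "(bit ^ 'n::finite) set \<Rightarrow> bool" where
  "singly_even C \<longleftrightarrow> (\<exists>c\<in>C. hamming_weight c mod 4 = 2)"

definition self_dual_bound :: "nat \<Rightarrow> nat" where
  "self_dual_bound n = (if n mod 24 = 22 then 4 * (n div 24) + 6 else 4 * (n div 24) + 4)"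

definition extremal :: "(bit ^ 'n::finite) set \<Rightarrow> bool" where
  "extremal C \<longleftrightarrow> min_weight C = self_dual_bound CARD('n)"

definition doubly_even_subcode :: "(bit ^ 'n::finite) set \<Rightarrow> (bit ^ 'n) set" where
  "doubly_even_subcode C = {c \<in> C. hamming_weight c mod 4 = 0}"

definition shadow :: "(bit ^ 'n::finite) set \<Rightarrow> (bit ^ 'n) set" where
  "shadow C = dual_code (doubly_even_subcode C) - C"

definition weight_enumerator :: "(bit ^ 'n::finite) set \<Rightarrow> int poly" where
  "weight_enumerator A =
     (\<Sum>i\<le>CARD('n). monom (int (card {v \<in> A. hamming_weight v = i})) i)"

text \<open>\<open>begins_with m p q\<close> formalizes \<open>p = q + \<cdots>\<close>, where all omitted terms have degree
  greater than \<open>m\<close>, the degree of the last displayed term.  The degree is passed explicitly because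
  that term may have coefficient zero.\<close>

definition begins_with :: "nat \<Rightarrow> int poly \<Rightarrow> int poly \<Rightarrow> bool" where
  "begins_with m p q \<longleftrightarrow> (\<exists>r. p = q + monom 1 (Suc m) * r)"

end

theory Submission imports Defs "HOL-Analysis.Convex" begin

text \<open>
  Two distinct shadow vectors of weight 7 differ by a nonzero codeword, so their supports meet in one
  point (sum of weight 12) or in none (sum of weight 14). The sum of two codewords of weights
  congruent modulo 4 has weight divisible by 4; hence meeting is an equivalence relation on the
  shadow vectors of weight 7, with at most two classes. The supports of the two classes lie in
  disjoint sets of \<open>v\<^sub>1\<close> and \<open>v\<^sub>2\<close> coordinates, \<open>v\<^sub>1 + v\<^sub>2 \<le> 62\<close>. A family of \<open>m\<close> sets of size 7 on
  \<open>v\<close> points that pairwise meet in one point satisfies \<open>49 m \<le> v (m + 6)\<close> by Cauchy-Schwarz, and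
  \<open>m \<le> 43\<close> unless all its sets share a point. These inequalities bound the total number of sets.
\<close>

section \<open>Uniform families pairwise meeting in one point\<close>

definition one_point_family :: "nat \<Rightarrow> 'a set set \<Rightarrow> bool" where
  "one_point_family k F \<longleftrightarrow>
     finite F \<and> (\<forall>A\<in>F. finite A \<and> card A = k) \<and> (\<forall>A\<in>F. \<forall>B\<in>F. A \<noteq> B \<longrightarrow> card (A \<inter> B) = 1)"

text \<open>Double counting over the points of the union. If \<open>r p\<close> is the number of
  sets through \<open>p\<close>, then \<open>r\<close> sums to \<open>k * card F\<close>, while the
  squares count triples (p, A, B) with p in both sets. Cauchy-Schwarz compares the two sums, and one
  factor \<open>card F\<close> cancels.\<close>

lemma one_point_family_Cauchy_Schwarz:
  assumes F: "one_point_family k F" and "k \<ge> 1"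
  shows "k\<^sup>2 * card F \<le> card (\<Union>F) * (card F + k - 1)"
proof (cases "card F = 0")
  case False
  have fin: "finite F" "finite (\<Union>F)" and finA: "\<And>A. A \<in> F \<Longrightarrow> finite A"
    using F by (auto simp: one_point_family_def)
  define r :: "'a \<Rightarrow> real" where "r p = (\<Sum>A\<in>F. of_bool (p \<in> A))" for p
  have count: "(\<Sum>p\<in>\<Union>F. of_bool (p \<in> D)) = real (card D)" if "D \<subseteq> A" "A \<in> F" for A D
  proof -
    have "\<Union>F \<inter> {p. p \<in> D} = D" using that by auto
    then show ?thesis using fin by (simp add: of_bool_def sum.If_cases)
  qed
  have "(\<Sum>p\<in>\<Union>F. r p) = (\<Sum>A\<in>F. \<Sum>p\<in>\<Union>F. of_bool (p \<in> A))"
    unfolding r_def by (rule sum.swap)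
  also have "\<dots> = (\<Sum>A\<in>F. real k)"
    using F count[OF subset_refl] by (intro sum.cong refl) (simp only: one_point_family_def)
  finally have sum1: "(\<Sum>p\<in>\<Union>F. r p) = real (card F * k)" by simp
  have "(\<Sum>p\<in>\<Union>F. (r p)\<^sup>2) = (\<Sum>p\<in>\<Union>F. \<Sum>A\<in>F. \<Sum>B\<in>F. of_bool (p \<in> A \<inter> B))"
    unfolding r_def power2_eq_square sum_product
    by (intro sum.cong refl) (simp add: of_bool_conj)
  also have "\<dots> = (\<Sum>A\<in>F. \<Sum>p\<in>\<Union>F. \<Sum>B\<in>F. of_bool (p \<in> A \<inter> B))"
    by (rule sum.swap)
  also have "\<dots> = (\<Sum>A\<in>F. \<Sum>B\<in>F. \<Sum>p\<in>\<Union>F. of_bool (p \<in> A \<inter> B))"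
    by (intro sum.cong refl sum.swap)
  also have "\<dots> = (\<Sum>A\<in>F. \<Sum>B\<in>F. real (card (A \<inter> B)))"
    using count by (intro sum.cong refl) (meson Int_lower1)
  \<comment> \<open>For fixed \<open>A\<close> the diagonal term contributes \<open>k\<close> and
    every other set contributes 1.\<close>
  also have "\<dots> = (\<Sum>A\<in>F. real (k + (card F - 1)))"
  proof (rule sum.cong[OF refl])
    fix A assume A: "A \<in> F"
    have "(\<Sum>B\<in>F - {A}. real (card (A \<inter> B))) = (\<Sum>B\<in>F - {A}. 1)"
      using F A by (intro sum.cong) (auto simp: one_point_family_def)
    moreover have "card A = k" using F A by (simp add: one_point_family_def)
    ultimately show "(\<Sum>B\<in>F. real (card (A \<inter> B))) = real (k + (card F - 1))"
      using sum.remove[OF fin(1) A, of "\<lambda>B. real (card (A \<inter> B))"] A fin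
      by (simp add: card_Diff_singleton)
  qed
  finally have sum2: "(\<Sum>p\<in>\<Union>F. (r p)\<^sup>2) = real (card F * (k + (card F - 1)))" by simp
  have "real ((card F * k)\<^sup>2) \<le> real (card F * (k + (card F - 1)) * card (\<Union>F))"
    using sum_squared_le_sum_of_squares[of r "\<Union>F"] sum1 sum2 fin by (simp add: mult.commute)
  then have "(card F * k)\<^sup>2 \<le> card F * (k + (card F - 1)) * card (\<Union>F)"
    by (simp only: of_nat_le_iff)
  then have "card F * (k\<^sup>2 * card F) \<le> card F * (card (\<Union>F) * (k + (card F - 1)))"
    by (simp add: power2_eq_square mult_ac)
  then show ?thesis using False by (simp add: add.commute)
qed simp

text \<open>Deleting the common point leaves pairwise disjoint sets of k - 1 points each.\<close>

lemma card_common_point: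
  assumes F: "one_point_family k F" and p: "\<And>A. A \<in> F \<Longrightarrow> p \<in> A"
  shows "(k - 1) * card F \<le> card (\<Union>F)"
proof -
  have fin: "finite F" "finite (\<Union>F)" using F by (auto simp: one_point_family_def)
  have disj: "(A - {p}) \<inter> (B - {p}) = {}" if AB: "A \<in> F" "B \<in> F" "A \<noteq> B" for A B
  proof -
    have "card (A \<inter> B) = 1" using F AB by (simp add: one_point_family_def)
    then obtain q where "A \<inter> B = {q}" by (rule card_1_singletonE)
    moreover have "p \<in> A \<inter> B" using p AB by blast
    ultimately have "A \<inter> B = {p}" by simp
    then show ?thesis by blast
  qed
  have "card (\<Union>A\<in>F. A - {p}) = (\<Sum>A\<in>F. card (A - {p}))"
    using F disj by (intro card_UN_disjoint) (auto simp: one_point_family_def)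
  also have "\<dots> = (\<Sum>A\<in>F. k - 1)"
    using F p by (intro sum.cong) (auto simp: one_point_family_def)
  finally have "(k - 1) * card F = card (\<Union>A\<in>F. A - {p})" by simp
  also have "\<dots> \<le> card (\<Union>F)" using fin by (intro card_mono) auto
  finally show ?thesis .
qed

text \<open>A set avoiding \<open>p\<close> meets the sets through \<open>p\<close> in distinct points.\<close>

lemma card_through_point:
  assumes F: "one_point_family k F" and B: "B \<in> F" "p \<notin> B"
  shows "card {A \<in> F. p \<in> A} \<le> k"
proof -
  have "\<exists>q. q \<in> A \<inter> B" if "A \<in> F" "p \<in> A" for A
    using F B that
    by (metis card.empty ex_in_conv one_point_family_def zero_neq_one)
  then obtain f where f: "\<And>A. A \<in> F \<Longrightarrow> p \<in> A \<Longrightarrow> f A \<in> A \<inter> B" by metis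
  have "inj_on f {A \<in> F. p \<in> A}"
  \<comment> \<open>Two sets through \<open>p\<close> with the same chosen point of \<open>B\<close>
    would share that point and also \<open>p\<close>, which lies outside \<open>B\<close>.\<close>
  proof (rule inj_onI, rule ccontr)
    fix A A' assume A: "A \<in> {A \<in> F. p \<in> A}" "A' \<in> {A \<in> F. p \<in> A}" "f A = f A'" "A \<noteq> A'"
    then have "{p, f A} \<subseteq> A \<inter> A'" and ne: "p \<noteq> f A" using f[of A] f[of A'] B by auto
    moreover have "finite (A \<inter> A')" "card (A \<inter> A') = 1"
      using F A by (auto simp: one_point_family_def)
    ultimately have "card {p, f A} \<le> 1" by (metis card_mono)
    then show False using ne by simp
  qed
  moreover have "f ` {A \<in> F. p \<in> A} \<subseteq> B" using f by auto
  moreover have "finite B" "card B = k" using F B by (auto simp: one_point_family_def)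
  ultimately show ?thesis using card_inj_on_le by metis
qed

text \<open>Fix a set \<open>A\<close>. Every other set passes through one of its k points, and
  since no point is common to all sets, each point lies on at most k sets, one of them being
  \<open>A\<close>. The bound is the number of lines of a projective plane of order k - 1.\<close>

lemma one_point_family_card_le:
  assumes F: "one_point_family k F" and "\<And>p. \<exists>A\<in>F. p \<notin> A"
  shows "card F \<le> k * (k - 1) + 1"
proof -
  have fin: "finite F" using F by (simp add: one_point_family_def)
  obtain A where A: "A \<in> F" using assms(2) by blast
  have finA: "finite A" and cA: "card A = k" using F A by (auto simp: one_point_family_def)
  have "F - {A} \<subseteq> (\<Union>p\<in>A. {B \<in> F. p \<in> B} - {A})"
  proof
    fix B assume "B \<in> F - {A}"
    then have "card (A \<inter> B) = 1" "B \<in> F - {A}" using F A by (auto simp: one_point_family_def)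
    then show "B \<in> (\<Union>p\<in>A. {B \<in> F. p \<in> B} - {A})" by (fastforce simp: card_1_singleton_iff)
  qed
  then have "card (F - {A}) \<le> card (\<Union>p\<in>A. {B \<in> F. p \<in> B} - {A})"
    using fin finA by (intro card_mono) auto
  also have "\<dots> \<le> (\<Sum>p\<in>A. card ({B \<in> F. p \<in> B} - {A}))"
    by (rule card_UN_le[OF finA])
  also have "\<dots> \<le> (\<Sum>p\<in>A. k - 1)"
  proof (rule sum_mono)
    fix p assume "p \<in> A"
    moreover have "card {B \<in> F. p \<in> B} \<le> k"
      using card_through_point[OF F] assms(2) by blast
    ultimately show "card ({B \<in> F. p \<in> B} - {A}) \<le> k - 1"
      using A fin by (simp add: card_Diff_singleton)
  qed
  finally show ?thesis using A fin cA by (simp add: card_Diff_singleton)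
qed

lemma one_point_family_7:
  assumes F: "one_point_family 7 F"
  shows "49 * card F \<le> card (\<Union>F) * (card F + 6)" "card F \<le> 43 \<or> 6 * card F \<le> card (\<Union>F)"
proof -
  show "49 * card F \<le> card (\<Union>F) * (card F + 6)"
    using one_point_family_Cauchy_Schwarz[OF F] by (simp add: add.commute)
  show "card F \<le> 43 \<or> 6 * card F \<le> card (\<Union>F)"
  proof (cases "\<exists>p. \<forall>A\<in>F. p \<in> A")
    case True
    then show ?thesis using card_common_point[OF F] by auto
  next
    case False
    then show ?thesis using one_point_family_card_le[OF F] by auto
  qed
qed

text \<open>Split on the size of the larger union. With at most 42 points the two families have at
  most 36 and 10 sets; with at least 43 points they have at most 43 and 3. Both cases give
  46.\<close>

lemma two_one_point_families_le:
  fixes F G :: "'a set set"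
  assumes F: "one_point_family 7 F" and G: "one_point_family 7 G"
    and sum: "card (\<Union>F) + card (\<Union>G) \<le> 62"
  shows "card F + card G \<le> 46"
proof -
  have bound: "card H * (49 - a) \<le> 6 * a" if "one_point_family 7 H" "card (\<Union>H) \<le> a" "a \<le> 49"
    for a and H :: "'a set set"
  proof -
    have "49 * card H \<le> a * (card H + 6)"
      using one_point_family_7(1)[OF that(1)] that(2) mult_le_mono1 le_trans by blast
    then show ?thesis using that(3) by (simp add: algebra_simps diff_mult_distrib2)
  qed
  have main: "card H + card K \<le> 46"
    if H: "one_point_family 7 H" and K: "one_point_family 7 K"
      and le: "card (\<Union>K) \<le> card (\<Union>H)" and s: "card (\<Union>H) + card (\<Union>K) \<le> 62"
    for H K :: "'a set set"
  proof -
    \<comment> \<open>The smaller union has at most 62 / 2 = 31 points, and 18 m \<le> 186 forces m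
      \<le> 10.\<close>
    have K10: "card K \<le> 10" using bound[OF K, of 31] le s by simp
    show ?thesis
    proof (cases "card (\<Union>H) \<le> 42")
      case True
      then have "card H \<le> 36" using bound[OF H, of 42] by simp
      then show ?thesis using K10 by simp
    next
      case False
      \<comment> \<open>Only 62 - 43 = 19 points remain, and 30 m \<le> 114 forces m \<le>
        3.\<close>
      then have "card K \<le> 3" using bound[OF K, of 19] s by simp
      \<comment> \<open>In the other alternative 6 m \<le> 62, which is far below 43.\<close>
      moreover have "card H \<le> 43" using one_point_family_7(2)[OF H] s by auto
      ultimately show ?thesis by simp
    qed
  qed
  show ?thesis using main[OF F G] main[OF G F] sum by (cases "card (\<Union>G) \<le> card (\<Union>F)") auto
qed

section \<open>Weights in a self-dual code and its shadow\<close>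

definition supp :: "bit ^ 'n::finite \<Rightarrow> 'n set" where
  "supp v = {i. v $ i \<noteq> 0}"

lemma hamming_weight_supp: "hamming_weight v = card (supp v)"
  by (simp add: hamming_weight_def supp_def)

lemma inj_supp: "inj supp"
proof (rule injI)
  fix u v :: "bit ^ 'n" assume "supp u = supp v"
  then have "u $ i \<noteq> 0 \<longleftrightarrow> v $ i \<noteq> 0" for i unfolding supp_def set_eq_iff by blast
  then show "u = v" by (metis bit_not_zero_iff vec_eq_iff)
qed

text \<open>Common coordinates cancel in the sum because 1 + 1 = 0. The additive form avoids
  subtraction of naturals.\<close>

lemma hamming_weight_add:
  "hamming_weight (u + v) + 2 * card (supp u \<inter> supp v) = hamming_weight u + hamming_weight v"
proof -
  have eq: "supp (u + v) = (supp u - supp v) \<union> (supp v - supp u)"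
    by (auto simp: supp_def)
  have "card (supp (u + v)) = card (supp u - supp v) + card (supp v - supp u)"
    unfolding eq by (rule card_Un_disjoint) auto
  moreover have "card (supp u) = card (supp u - supp v) + card (supp u \<inter> supp v)"
    by (metis add.commute card_Diff_subset_Int card_mono finite inf_le1 le_add_diff_inverse)
  moreover have "card (supp v) = card (supp v - supp u) + card (supp u \<inter> supp v)"
    by (metis add.commute card_Diff_subset_Int card_mono finite inf_commute inf_le1
        le_add_diff_inverse)
  ultimately show ?thesis by (simp add: hamming_weight_supp)
qed

lemma dot_eq_0_iff: "dot u v = 0 \<longleftrightarrow> even (card (supp u \<inter> supp v))"
proof -
  have "dot u v = (\<Sum>i\<in>UNIV. of_bool (i \<in> supp u \<inter> supp v))"
    unfolding dot_def by (intro sum.cong) (auto simp: supp_def)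
  also have "\<dots> = of_nat (card (supp u \<inter> supp v))"
    by (simp add: Int_def)
  moreover have "b = 0 \<longleftrightarrow> even b" for b :: bit
    by (cases b) simp_all
  ultimately show ?thesis by (simp only: even_of_nat)
qed

lemma dot_add_left: "dot (u + v) c = dot u c + dot v c"
  unfolding dot_def by (simp only: vector_add_component distrib_right sum.distrib)

lemma dot_add_right: "dot u (c + d) = dot u c + dot u d"
  unfolding dot_def by (simp only: vector_add_component distrib_left sum.distrib)

lemma add_self_bit_vec [simp]: "(v :: bit ^ 'n) + v = 0"
  by (simp add: vec_eq_iff)

lemma add_eq_0_bit_vec_iff: "(u :: bit ^ 'n) + v = 0 \<longleftrightarrow> u = v"
  using add_left_cancel[of u v u] by (simp only: add_self_bit_vec eq_commute[of v])

lemma add_cancel_bit_vec: "(u + v) + (v + w) = (u + w :: bit ^ 'n)"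
proof -
  have "(u + v) + (v + w) = u + (v + v) + w" by (simp only: add.assoc)
  then show ?thesis by (simp only: add_self_bit_vec add_0_right)
qed

lemma self_dual_add:
  assumes "self_dual C" "x \<in> C" "y \<in> C"
  shows "x + y \<in> C"
proof -
  have "x \<in> dual_code C" "y \<in> dual_code C" using assms by (auto simp: self_dual_def)
  then have "x + y \<in> dual_code C" by (simp add: dual_code_def dot_add_left)
  then show ?thesis using assms(1) by (simp add: self_dual_def)
qed

lemma self_dual_dot:
  assumes "self_dual C" "x \<in> C" "y \<in> C"
  shows "dot x y = 0"
proof -
  have "x \<in> dual_code C" using assms by (auto simp: self_dual_def)
  then show ?thesis using assms by (simp add: dual_code_def)
qed

lemma self_dual_even_weight:
  assumes "self_dual C" "x \<in> C"
  shows "even (hamming_weight x)"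
  using self_dual_dot[OF assms assms(2)] by (simp add: dot_eq_0_iff hamming_weight_supp)

text \<open>Both weights are even and congruent modulo 4, so they add up to a multiple of 4;
  orthogonality makes the overlap even, so twice the overlap is a multiple of 4 as well.\<close>

lemma self_dual_weight_add_mod_4:
  assumes "self_dual C" "x \<in> C" "y \<in> C" "hamming_weight x mod 4 = hamming_weight y mod 4"
  shows "hamming_weight (x + y) mod 4 = 0"
proof -
  have "even (card (supp x \<inter> supp y))" using self_dual_dot[OF assms(1-3)] by (simp add: dot_eq_0_iff)
  then have "4 dvd 2 * card (supp x \<inter> supp y)" by auto
  moreover have "4 dvd hamming_weight x + hamming_weight y"
    using self_dual_even_weight[OF assms(1,2)] assms(4) by presburger
  ultimately have "4 dvd hamming_weight (x + y)"
    using hamming_weight_add[of x y] by (metis dvd_add_left_iff)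
  then show ?thesis by simp
qed

text \<open>All shadow vectors induce the same functional on \<open>C\<close>: it vanishes on the
  doubly even subcode but not on all of \<open>C\<close>, and any two codewords outside the subcode
  differ by an element of it.\<close>

lemma shadow_dot:
  assumes C: "self_dual C" and u: "u \<in> shadow C" and c: "c \<in> C"
  shows "dot u c = of_bool (hamming_weight c mod 4 \<noteq> 0)"
proof -
  have 0: "dot u d = 0" if "d \<in> C" "hamming_weight d mod 4 = 0" for d
    using u that by (auto simp: shadow_def dual_code_def doubly_even_subcode_def)
  have "u \<notin> dual_code C" using u C by (auto simp: shadow_def self_dual_def)
  then obtain e where e: "e \<in> C" "dot u e \<noteq> 0" by (auto simp: dual_code_def)
  then have e4: "hamming_weight e mod 4 \<noteq> 0" using 0 by blast
  have "dot u c \<noteq> 0" if c4: "hamming_weight c mod 4 \<noteq> 0"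
  proof -
    have "hamming_weight c mod 4 = hamming_weight e mod 4"
      using self_dual_even_weight[OF C c] self_dual_even_weight[OF C e(1)] c4 e4 by presburger
    then have "hamming_weight (c + e) mod 4 = 0" by (rule self_dual_weight_add_mod_4[OF C c e(1)])
    then have "dot u (c + e) = 0" by (rule 0[OF self_dual_add[OF C c e(1)]])
    then have "dot u c + dot u e = 0" by (simp only: dot_add_right)
    then show ?thesis using e(2) by auto
  qed
  then show ?thesis using 0 c by auto
qed

text \<open>The equal inner products with each codeword cancel, so the sum lies in the dual, which
  is \<open>C\<close>.\<close>

lemma shadow_add:
  assumes C: "self_dual C" and "u \<in> shadow C" "v \<in> shadow C"
  shows "u + v \<in> C"
proof -
  have "u + v \<in> dual_code C"
    by (auto simp: dual_code_def dot_add_left shadow_dot[OF C assms(2)] shadow_dot[OF C assms(3)])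
  then show ?thesis using C by (simp add: self_dual_def)
qed

lemma min_weight_le:
  fixes v :: "bit ^ 'n::finite"
  assumes "v \<in> A" "v \<noteq> 0"
  shows "min_weight A \<le> hamming_weight v"
proof -
  have "hamming_weight w \<le> CARD('n)" for w :: "bit ^ 'n"
    unfolding hamming_weight_def by (rule card_mono) auto
  then have "hamming_weight ` (A - {0}) \<subseteq> {..CARD('n)}" by auto
  then have "finite (hamming_weight ` (A - {0}))" using finite_subset by blast
  then show ?thesis unfolding min_weight_def using assms by (intro Min_le) auto
qed

section \<open>Shadow vectors of weight 7\<close>

lemma card_shadow_weight_7_le:
  fixes C :: "(bit ^ 'n::finite) set"
  assumes C: "self_dual C" and min: "min_weight C = 12" and n: "CARD('n) = 62"
  shows "card {v \<in> shadow C. hamming_weight v = 7} \<le> 46"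
proof (cases "{v \<in> shadow C. hamming_weight v = 7} = {}")
  case True
  show ?thesis unfolding True card.empty by (rule zero_le)
next
  case False
  define S where "S = {v \<in> shadow C. hamming_weight v = 7}"
  obtain a where a: "a \<in> S" using False by (auto simp: S_def)
  have w12: "hamming_weight x \<ge> 12" if "x \<in> C" "x \<noteq> 0" for x
    using min_weight_le[OF that] min by simp
  have sumC: "u + v \<in> C" if "u \<in> S" "v \<in> S" for u v
    using shadow_add[OF C] that by (auto simp: S_def)
  have weight: "hamming_weight (u + v) + 2 * card (supp u \<inter> supp v) = 14"
    if "u \<in> S" "v \<in> S" for u v
    using hamming_weight_add[of u v] that by (simp add: S_def)
  \<comment> \<open>The sum has weight at least 12, and weight plus twice the overlap is 14. So
    overlap 1 means weight 12, and overlap 0 means weight 14, which is 2 modulo 4.\<close>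
  have meet: "card (supp u \<inter> supp v) = (if hamming_weight (u + v) mod 4 = 0 then 1 else 0)"
    if uv: "u \<in> S" "v \<in> S" "u \<noteq> v" for u v
  proof -
    have "hamming_weight (u + v) \<ge> 12"
      using w12 sumC uv by (simp add: add_eq_0_bit_vec_iff)
    then have "card (supp u \<inter> supp v) \<le> 1" using weight[OF uv(1,2)] by linarith
    then consider "card (supp u \<inter> supp v) = 0" | "card (supp u \<inter> supp v) = 1" by linarith
    then show ?thesis using weight[OF uv(1,2)] by cases auto
  qed
  \<comment> \<open>\<open>R True\<close> is the class of \<open>a\<close> under the meeting
    relation, containing \<open>a\<close> itself since a + a = 0; \<open>R False\<close> is the
    rest, possibly empty.\<close>
  define R where "R b = {v \<in> S. (hamming_weight (a + v) mod 4 = 0) = b}" for b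
  have mod2: "hamming_weight (a + u) mod 4 = 0 \<or> hamming_weight (a + u) mod 4 = 2" if "u \<in> S" for u
    using self_dual_even_weight[OF C sumC[OF a that]] by presburger
  have same: "hamming_weight (u + v) mod 4 = 0" if "u \<in> R b" "v \<in> R b" for u v b
  proof -
    have uv: "u \<in> S" "v \<in> S" using that by (auto simp: R_def)
    have "hamming_weight (a + u) mod 4 = hamming_weight (a + v) mod 4"
      using that mod2[of u] mod2[of v] by (auto simp: R_def)
    \<comment> \<open>Write u + v as a sum of two codewords whose weights agree modulo 4.\<close>
    then have "hamming_weight ((u + a) + (a + v)) mod 4 = 0"
      using self_dual_weight_add_mod_4[OF C sumC sumC] a uv by (metis add.commute)
    then show ?thesis by (simp only: add_cancel_bit_vec)
  qed
  have diff: "hamming_weight (u + v) mod 4 \<noteq> 0" if "u \<in> R True" "v \<in> R False" for u v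
  proof
    assume 0: "hamming_weight (u + v) mod 4 = 0"
    have uv: "u \<in> S" "v \<in> S" using that by (auto simp: R_def)
    \<comment> \<open>Both weights are 0 modulo 4, so a + v = (a + u) + (u + v) would have weight 0
      modulo 4, against \<open>v\<close> being in \<open>R False\<close>.\<close>
    have "hamming_weight (a + u) mod 4 = hamming_weight (u + v) mod 4"
      using that(1) 0 by (simp add: R_def)
    then have "hamming_weight ((a + u) + (u + v)) mod 4 = 0"
      using self_dual_weight_add_mod_4[OF C sumC sumC] a uv by blast
    then show False using that(2) unfolding add_cancel_bit_vec R_def by simp
  qed
  have fam: "one_point_family 7 (supp ` R b)" for b
    unfolding one_point_family_def
  proof (intro conjI ballI impI)
    fix A B assume "A \<in> supp ` R b" "B \<in> supp ` R b" "A \<noteq> B"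
    then obtain u v where uv: "u \<in> R b" "v \<in> R b" "A = supp u" "B = supp v" "u \<noteq> v" by auto
    then show "card (A \<inter> B) = 1"
      using meet[of u v] same[of u b v] by (simp add: R_def)
  qed (auto simp: R_def S_def hamming_weight_supp)
  have "supp u \<inter> supp v = {}" if "u \<in> R True" "v \<in> R False" for u v
  proof -
    have "u \<noteq> v" "u \<in> S" "v \<in> S" using that by (auto simp: R_def)
    then have "card (supp u \<inter> supp v) = 0" using meet diff[OF that] by simp
    then show ?thesis by simp
  qed
  then have "\<Union>(supp ` R True) \<inter> \<Union>(supp ` R False) = {}" by blast
  then have "card (\<Union>(supp ` R True)) + card (\<Union>(supp ` R False))
      = card (\<Union>(supp ` R True) \<union> \<Union>(supp ` R False))"
    by (intro card_Un_disjoint[symmetric]) auto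
  also have "\<dots> \<le> 62" unfolding n[symmetric] by (rule card_mono) auto
  finally have "card (supp ` R True) + card (supp ` R False) \<le> 46"
    by (rule two_one_point_families_le[OF fam fam])
  then have le: "card (R True) + card (R False) \<le> 46"
    by (simp add: card_image inj_on_subset[OF inj_supp])
  have "S = R True \<union> R False" by (auto simp: R_def)
  then have "card S \<le> card (R True) + card (R False)" by (simp add: card_Un_le)
  then show ?thesis using le by (simp add: S_def)
qed

section \<open>Coefficients of weight enumerators and the bound on \<beta>\<close>

lemma coeff_weight_enumerator:
  fixes A :: "(bit ^ 'n::finite) set"
  assumes "i \<le> CARD('n)"
  shows "coeff (weight_enumerator A) i = int (card {v \<in> A. hamming_weight v = i})"
proof -
  have "coeff (weight_enumerator A) i =
      (\<Sum>j\<le>CARD('n). if j = i then int (card {v \<in> A. hamming_weight v = j}) else 0)"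
    by (simp only: weight_enumerator_def coeff_sum coeff_monom)
  then show ?thesis using assms by (simp only: sum.delta finite_atMost atMost_iff if_True)
qed

text \<open>The omitted terms form a multiple of the monomial of degree m + 1 and cannot affect
  coefficients up to m.\<close>

lemma begins_with_coeff:
  assumes "begins_with m p q" "i \<le> m"
  shows "coeff p i = coeff q i"
proof -
  obtain r where "p = q + monom 1 (Suc m) * r" using assms(1) unfolding begins_with_def by blast
  then show ?thesis using assms(2) by (simp add: coeff_monom_mult)
qed

theorem proposition4:
  fixes \<beta> :: int
  assumes "\<exists>C :: (bit ^ 62) set.
      linear_code 62 31 12 C \<and> self_dual C \<and> singly_even C \<and> extremal C \<and>
      min_weight (shadow C) \<ge> 7 \<and>
      begins_with 14 (weight_enumerator C)
        (1 + monom (1860 + 32 * \<beta>) 12 + monom (28055 - 160 * \<beta>) 14) \<and>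
      begins_with 15 (weight_enumerator (shadow C))
        (monom \<beta> 7 + monom (1116 - 12 * \<beta>) 11 + monom (171368 + 66 * \<beta>) 15)"
  shows "0 \<le> \<beta> \<and> \<beta> \<le> 48"
proof -
  obtain C :: "(bit ^ 62) set" where C: "linear_code 62 31 12 C" "self_dual C"
    and S: "begins_with 15 (weight_enumerator (shadow C))
        (monom \<beta> 7 + monom (1116 - 12 * \<beta>) 11 + monom (171368 + 66 * \<beta>) 15)"
    using assms by blast
  \<comment> \<open>As a cardinality \<beta> is nonnegative, and the count of weight 7 shadow
    vectors gives 46, slightly below the claimed 48.\<close>
  have "\<beta> = int (card {v \<in> shadow C. hamming_weight v = 7})"
    using begins_with_coeff[OF S, of 7] coeff_weight_enumerator[of 7 "shadow C"]
    by (simp add: coeff_monom)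
  moreover have "card {v \<in> shadow C. hamming_weight v = 7} \<le> 46"
    using C by (intro card_shadow_weight_7_le) (simp_all only: linear_code_def)
  ultimately show ?thesis by simp
qed

end
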